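(* Let $(X,\tau)$ be a strong Mackey locally convex space and let $\{T(t)\}_{t\ge 0}$ be a semigroup of continuous linear operators on $(X,\tau)$. Then $\{T(t)\}_{t\ge 0}$ is strongly continuous if and only if the following two statements hold: (i) there is a dense subset $D\subseteq X$ such that $\lim_{t\to 0} T(t)x = x$ for every $x\in D$; (ii) $\{T(t)\}_{t\ge 0}$ is locally equi-continuous.
   Context: A locally convex space $(X,\tau)$ with continuous dual $X'$ is called strong Mackey if all $\sigma(X',X)$-compact sets in $X'$ are equi-continuous. A semigroup is a family of linear operators $\{T(t)\}_{t\ge0}$ on $X$ with $T(0)=\mathrm{Id}$ and $T(t)T(s)=T(t+s)$ for $s,t\ge 0$. A semigroup of $\tau$-continuous operators is strongly continuous if $t\mapsto T(t)x$ is $\tau$-continuous on $[0,\infty)$ for every $x\in X$. It is locally equi-continuous if for every $t\ge 0$ and every continuous semi-norm $p$ there exists a continuous semi-norm $q$ such that $\sup_{s\le t}p(T(s)x)\le q(x)$ for every $x\in X$. *)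

theory Defs
  imports "HOL-Analysis.Analysis"
begin

text \<open>
  The scalars range over a type \<open>'k\<close> of sort \<open>{real_normed_field, euclidean_space}\<close>: up to
  isometric isomorphism such a field is \<open>real\<close> or \<open>complex\<close>, so real and complex
  spaces are treated together. The space is the type \<open>'a\<close> with its class topology and the scalar
  multiplication \<open>smul\<close>; no Hausdorff axiom is imposed.
\<close>

definition convex_wrt :: "('k::real_normed_field \<Rightarrow> 'a::ab_group_add \<Rightarrow> 'a) \<Rightarrow> 'a set \<Rightarrow> bool" where
  "convex_wrt smul V \<longleftrightarrow>
    (\<forall>x\<in>V. \<forall>y\<in>V. \<forall>u\<ge>0. \<forall>v\<ge>0. u + v = 1 \<longrightarrow> smul (of_real u) x + smul (of_real v) y \<in> V)"

locale locally_convex_space = vector_space smul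
  for smul :: "'k::{real_normed_field, euclidean_space} \<Rightarrow> 'a::topological_ab_group_add \<Rightarrow> 'a" +
  assumes continuous_scale: "continuous_on UNIV (\<lambda>(c, x). smul c x)"
    and convex_nhds_zero:
      "\<And>U. open U \<Longrightarrow> 0 \<in> U \<Longrightarrow> \<exists>V. convex_wrt smul V \<and> 0 \<in> interior V \<and> V \<subseteq> U"

definition continuous_dual ::
  "('k::{real_normed_field, euclidean_space} \<Rightarrow> 'a::topological_ab_group_add \<Rightarrow> 'a) \<Rightarrow> ('a \<Rightarrow> 'k) set" where
  "continuous_dual smul = {f. Vector_Spaces.linear smul (*) f \<and> continuous_on UNIV f}"

text \<open>The topology \<open>\<sigma>(X',X)\<close>, the coarsest one on \<open>X'\<close> making all evaluations continuous.\<close>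

definition weak_star_topology ::
  "('k::{real_normed_field, euclidean_space} \<Rightarrow> 'a::topological_ab_group_add \<Rightarrow> 'a) \<Rightarrow> ('a \<Rightarrow> 'k) topology" where
  "weak_star_topology smul =
    topology_generated_by {{f \<in> continuous_dual smul. f x \<in> U} | x U. open U}"

definition equicontinuous :: "('a::topological_space \<Rightarrow> 'k::metric_space) set \<Rightarrow> bool" where
  "equicontinuous K \<longleftrightarrow> (\<forall>x. \<forall>e>0. \<forall>\<^sub>F y in nhds x. \<forall>f\<in>K. dist (f y) (f x) < e)"

locale strong_mackey_space = locally_convex_space smul
  for smul :: "'k::{real_normed_field, euclidean_space} \<Rightarrow> 'a::topological_ab_group_add \<Rightarrow> 'a" +
  assumes strong_mackey: "\<And>K. compactin (weak_star_topology smul) K \<Longrightarrow> equicontinuous K"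

definition continuous_seminorm ::
  "('k::real_normed_field \<Rightarrow> 'a::topological_ab_group_add \<Rightarrow> 'a) \<Rightarrow> ('a \<Rightarrow> real) \<Rightarrow> bool" where
  "continuous_seminorm smul p \<longleftrightarrow>
    (\<forall>x. 0 \<le> p x) \<and> (\<forall>x y. p (x + y) \<le> p x + p y) \<and>
    (\<forall>c x. p (smul c x) = norm c * p x) \<and> continuous_on UNIV p"

text \<open>A semigroup is a family indexed by \<open>real\<close> of which only the indices \<open>t \<ge> 0\<close> matter.\<close>

definition operator_semigroup ::
  "('k::real_normed_field \<Rightarrow> 'a::ab_group_add \<Rightarrow> 'a) \<Rightarrow> (real \<Rightarrow> 'a \<Rightarrow> 'a) \<Rightarrow> bool" where
  "operator_semigroup smul T \<longleftrightarrow>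
    (\<forall>t\<ge>0. Vector_Spaces.linear smul smul (T t)) \<and> T 0 = id \<and>
    (\<forall>t\<ge>0. \<forall>s\<ge>0. T t \<circ> T s = T (t + s))"

definition strongly_continuous :: "(real \<Rightarrow> 'a \<Rightarrow> 'a::topological_space) \<Rightarrow> bool" where
  "strongly_continuous T \<longleftrightarrow> (\<forall>x. continuous_on {0..} (\<lambda>t. T t x))"

text \<open>
  \<open>sup\<^bsub>s\<le>t\<^esub> p (T s x) \<le> q x\<close> is stated pointwise in \<open>s\<close>, because the supremum over
  an unbounded set of reals is unspecified.
\<close>

definition locally_equicontinuous ::
  "('k::real_normed_field \<Rightarrow> 'a::topological_ab_group_add \<Rightarrow> 'a) \<Rightarrow> (real \<Rightarrow> 'a \<Rightarrow> 'a) \<Rightarrow> bool" where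
  "locally_equicontinuous smul T \<longleftrightarrow>
    (\<forall>t\<ge>0. \<forall>p. continuous_seminorm smul p \<longrightarrow>
      (\<exists>q. continuous_seminorm smul q \<and> (\<forall>x. \<forall>s\<in>{0..t}. p (T s x) \<le> q x)))"

end

theory Submission
  imports Defs
begin

text \<open>
  Suppose \<open>T\<close> is strongly continuous and \<open>p\<close> is a continuous seminorm. The polar
  \<open>U = {f. \<bar>f\<bar> \<le> p}\<close> is compact for pointwise convergence (Banach-Alaoglu), and \<open>U\<close> is
  equicontinuous, so \<open>(s, f) \<mapsto> f \<circ> T s\<close> is jointly continuous into the weak-star topology.
  Hence \<open>{f \<circ> T s | f \<in> U, s \<le> t}\<close> is weak-star compact and, by the strong Mackey property,
  equicontinuous. By Hahn-Banach its supremum is \<open>q x = sup\<^bsub>s\<le>t\<^esub> p (T s x)\<close>, which is therefore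
  a continuous seminorm. Conversely, local equicontinuity extends the convergence at \<open>0\<close> from the
  dense set to the whole space, and continuity elsewhere follows from
  \<open>p (T t x - T s x) \<le> q (T \<bar>t - s\<bar> x - x)\<close>.

  Hahn-Banach is obtained from minimal sublinear functionals: such a functional is additive,
  because otherwise its slope along some \<open>y\<close> would be strictly smaller.
\<close>

lemma continuous_on_UNIV_tendsto:
  assumes "continuous_on UNIV f" "(g \<longlongrightarrow> a) F"
  shows "((\<lambda>x. f (g x)) \<longlongrightarrow> f a) F"
  using continuous_on_tendsto_compose[OF assms] by simp

section \<open>Sublinear functionals and the real Hahn-Banach theorem\<close>

text \<open>The real scalar multiplication is a parameter because it will be \<open>smul\<close>
  restricted along \<open>of_real\<close>, not a type class instance.\<close>

definition sublinear :: "(real \<Rightarrow> 'a::ab_group_add \<Rightarrow> 'a) \<Rightarrow> ('a \<Rightarrow> real) \<Rightarrow> bool" where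
  "sublinear sc h \<longleftrightarrow>
    (\<forall>x y. h (x + y) \<le> h x + h y) \<and> (\<forall>r\<ge>0. \<forall>x. h (sc r x) = r * h x)"

context
  fixes sc :: "real \<Rightarrow> 'a::ab_group_add \<Rightarrow> 'a"
  assumes vs: "vector_space sc"
begin

interpretation vector_space sc by (fact vs)

text \<open>For positive \<open>r\<close> the inequality alone gives equality: applied to
  \<open>inverse r\<close> and \<open>sc r x\<close> it yields the reverse bound.\<close>

lemma sublinearI:
  assumes add: "\<And>x y. h (x + y) \<le> h x + h y"
    and zero: "h 0 = 0"
    and le: "\<And>r x. r > 0 \<Longrightarrow> h (sc r x) \<le> r * h x"
  shows "sublinear sc h"
  unfolding sublinear_def
proof (intro conjI allI impI add)
  fix r :: real and x
  assume "r \<ge> 0"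
  show "h (sc r x) = r * h x"
  proof (cases "r = 0")
    case False
    then have r: "r > 0" using \<open>r \<ge> 0\<close> by simp
    have "h x \<le> inverse r * h (sc r x)"
      using le[of "inverse r" "sc r x"] r by simp
    then have "r * h x \<le> h (sc r x)"
      using r by (simp add: field_simps)
    then show ?thesis using le[OF r, of x] by simp
  qed (simp add: zero)
qed

lemma sublinear_zero: "sublinear sc h \<Longrightarrow> h 0 = 0"
  unfolding sublinear_def by (metis mult_zero_left order_refl scale_zero_left)

lemma sublinear_ge_minus:
  assumes "sublinear sc h"
  shows "- h (- x) \<le> h x"
proof -
  have "h (x + - x) \<le> h x + h (- x)"
    using assms unfolding sublinear_def by blast
  then show ?thesis by (simp add: sublinear_zero[OF assms])
qed

text \<open>For sublinear \<open>h\<close> and \<open>t > 0\<close>, homogeneity turns the term into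
  the difference quotient of \<open>h\<close> at \<open>y\<close> in direction \<open>x\<close> with
  step \<open>1 / t\<close>, so this is a one-sided directional derivative. The term at
  \<open>t = 0\<close> puts it below \<open>h\<close>.\<close>

definition slope :: "('a \<Rightarrow> real) \<Rightarrow> 'a \<Rightarrow> 'a \<Rightarrow> real" where
  "slope h y x = (INF t\<in>{0..}. h (x + sc t y) - t * h y)"

text \<open>The infimum is a genuine one: writing \<open>sc t y\<close> as
  \<open>(x + sc t y) + - x\<close>, subadditivity bounds every term below by
  \<open>- h (- x)\<close>.\<close>

lemma slope_le:
  assumes h: "sublinear sc h" and t: "t \<ge> 0"
  shows "slope h y x \<le> h (x + sc t y) - t * h y"
  unfolding slope_def
proof (rule cINF_lower)
  show "bdd_below ((\<lambda>t. h (x + sc t y) - t * h y) ` {0..})"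
  proof (rule bdd_belowI2)
    fix t :: real assume "t \<in> {0..}"
    then have "t * h y = h ((x + sc t y) + - x)"
      using h by (simp add: sublinear_def)
    also have "\<dots> \<le> h (x + sc t y) + h (- x)"
      using h unfolding sublinear_def by blast
    finally show "- h (- x) \<le> h (x + sc t y) - t * h y" by simp
  qed
qed (use t in simp)

lemma slope_greatest:
  assumes "\<And>t. t \<ge> 0 \<Longrightarrow> c \<le> h (x + sc t y) - t * h y"
  shows "c \<le> slope h y x"
  unfolding slope_def using assms by (intro cINF_greatest) auto

text \<open>Parameters add and scale along with the arguments: the terms at \<open>s\<close> for
  \<open>u\<close> and at \<open>t\<close> for \<open>v\<close> together dominate the term at
  \<open>s + t\<close> for \<open>u + v\<close>, and \<open>r\<close> times the term at
  \<open>t\<close> for \<open>u\<close> is the term at \<open>r * t\<close> for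
  \<open>sc r u\<close>.\<close>

lemma sublinear_slope:
  assumes h: "sublinear sc h"
  shows "sublinear sc (slope h y)"
proof (rule sublinearI)
  have add: "h (u + v) \<le> h u + h v" for u v
    using h by (simp add: sublinear_def)
  have hom: "r \<ge> 0 \<Longrightarrow> h (sc r u) = r * h u" for r u
    using h by (simp add: sublinear_def)
  show "slope h y (u + v) \<le> slope h y u + slope h y v" for u v
  proof -
    have *: "slope h y (u + v) \<le> (h (u + sc s y) - s * h y) + (h (v + sc t y) - t * h y)"
      if "s \<ge> 0" "t \<ge> 0" for s t
    proof -
      have "slope h y (u + v) \<le> h ((u + v) + sc (s + t) y) - (s + t) * h y"
        using slope_le[OF h] that by simp
      also have "(u + v) + sc (s + t) y = (u + sc s y) + (v + sc t y)"
        by (simp add: scale_left_distrib)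
      finally show ?thesis
        using add[of "u + sc s y" "v + sc t y"] by (simp add: algebra_simps)
    qed
    have "slope h y (u + v) - (h (v + sc t y) - t * h y) \<le> slope h y u" if "t \<ge> 0" for t
      by (rule slope_greatest) (use *[OF _ that] in \<open>simp add: algebra_simps\<close>)
    then have "slope h y (u + v) - slope h y u \<le> slope h y v"
      by (intro slope_greatest) (simp add: algebra_simps)
    then show ?thesis by simp
  qed
  show "slope h y 0 = 0"
    unfolding slope_def by (simp add: hom)
  show "slope h y (sc r u) \<le> r * slope h y u" if r: "r > 0" for r u
  proof -
    have "slope h y (sc r u) / r \<le> slope h y u"
    proof (rule slope_greatest)
      fix t :: real assume t: "t \<ge> 0"
      have "slope h y (sc r u) \<le> h (sc r u + sc (r * t) y) - (r * t) * h y"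
        using r t by (intro slope_le[OF h]) simp
      also have "sc r u + sc (r * t) y = sc r (u + sc t y)"
        by (simp add: scale_right_distrib)
      also have "h \<dots> = r * h (u + sc t y)" using r by (simp add: hom)
      finally show "slope h y (sc r u) / r \<le> h (u + sc t y) - t * h y"
        using r by (simp add: field_simps)
    qed
    then show ?thesis using r by (simp add: field_simps)
  qed
qed

text \<open>Zorn's lemma applies because the pointwise infimum of a chain below \<open>p\<close> is
  again sublinear; it is finite since every member is at least \<open>- p (- x)\<close> at
  \<open>x\<close>.\<close>

lemma minimal_sublinear_exists:
  assumes p: "sublinear sc p"
  obtains h where "sublinear sc h" "h \<le> p" "\<And>g. sublinear sc g \<Longrightarrow> g \<le> h \<Longrightarrow> g = h"
proof -
  define S where "S = {h. sublinear sc h \<and> h \<le> p}"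
  have "\<exists>m\<in>S. \<forall>a\<in>S. a \<le> m \<longrightarrow> a = m"
  proof (rule predicate_Zorn)
    \<comment> \<open>The order is reversed, so that the maximal element delivered by Zorn's lemma
      is a minimal functional.\<close>
    show "partial_order_on S (relation_of (\<lambda>f g. g \<le> f) S)"
      by (rule partial_order_on_relation_ofI) auto
    fix C assume C: "C \<in> Chains (relation_of (\<lambda>f g. g \<le> f) S)"
    show "\<exists>u\<in>S. \<forall>a\<in>C. u \<le> a"
    proof (cases "C = {}")
      case True
      then show ?thesis using p by (auto simp: S_def)
    next
      case False
      have CS: "C \<subseteq> S" and total: "\<And>f g. f \<in> C \<Longrightarrow> g \<in> C \<Longrightarrow> f \<le> g \<or> g \<le> f"
        using C by (auto simp: Chains_def relation_of_def)
      have sub: "sublinear sc f" and fp: "f \<le> p" if "f \<in> C" for f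
        using CS that by (auto simp: S_def)
      define u where "u x = (INF f\<in>C. f x)" for x
      have bdd: "bdd_below ((\<lambda>f. f x) ` C)" for x
      proof (rule bdd_belowI2)
        fix f assume "f \<in> C"
        then show "- p (- x) \<le> f x"
          using sublinear_ge_minus[OF sub, of f x] le_funD[OF fp, of f "- x"] by linarith
      qed
      have lower: "u x \<le> f x" if "f \<in> C" for f x
        unfolding u_def using bdd that by (rule cINF_lower)
      have greatest: "c \<le> u x" if "\<And>f. f \<in> C \<Longrightarrow> c \<le> f x" for c x
        unfolding u_def using False that by (rule cINF_greatest)
      have "sublinear sc u"
      proof (rule sublinearI)
        fix x y
        have *: "u (x + y) \<le> f x + g y" if fg: "f \<in> C" "g \<in> C" for f g
        proof -
          \<comment> \<open>A chain has a member below both \<open>f\<close> and \<open>g\<close>,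
            and the subadditivity of this single member is enough.\<close>
          obtain k where k: "k \<in> C" "k \<le> f" "k \<le> g"
            using total[OF fg] fg by blast
          have "u (x + y) \<le> k (x + y)" using lower k(1) .
          also have "\<dots> \<le> k x + k y" using sub[OF k(1)] by (simp add: sublinear_def)
          also have "\<dots> \<le> f x + g y" using k by (simp add: le_fun_def add_mono)
          finally show ?thesis .
        qed
        have "u (x + y) - g y \<le> u x" if "g \<in> C" for g
          by (rule greatest) (use *[OF _ that] in \<open>simp add: algebra_simps\<close>)
        then have "u (x + y) - u x \<le> u y"
          by (intro greatest) (simp add: algebra_simps)
        then show "u (x + y) \<le> u x + u y" by simp
      next
        have "f 0 = 0" if "f \<in> C" for f using sublinear_zero[OF sub[OF that]] .
        then show "u 0 = 0" 
          using False unfolding u_def by (subst INF_cong[OF refl, of _ _ "\<lambda>_. 0"]) auto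
      next
        fix r :: real and x assume r: "r > 0"
        have "u (sc r x) / r \<le> u x"
        proof (rule greatest)
          fix f assume f: "f \<in> C"
          have "u (sc r x) \<le> r * f x"
            using lower[OF f, of "sc r x"] sub[OF f] r by (simp add: sublinear_def)
          then show "u (sc r x) / r \<le> f x" using r by (simp add: field_simps)
        qed
        then show "u (sc r x) \<le> r * u x" using r by (simp add: field_simps)
      qed
      moreover have "u \<le> p"
      proof (rule le_funI)
        fix x
        obtain f where "f \<in> C" using False by blast
        then show "u x \<le> p x" using lower[of f x] le_funD[OF fp, of f x] by linarith
      qed
      ultimately show ?thesis using lower by (auto simp: S_def le_fun_def)
    qed
  qed
  then obtain m where m: "m \<in> S" "\<And>a. a \<in> S \<Longrightarrow> a \<le> m \<Longrightarrow> a = m" by blast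
  show thesis
  proof (rule that)
    show "sublinear sc m" "m \<le> p" using m(1) by (auto simp: S_def)
    fix g assume "sublinear sc g" "g \<le> m"
    then show "g = m" using m by (auto simp: S_def intro: order_trans)
  qed
qed

text \<open>Minimality forces \<open>slope h y = h\<close>; the term of the slope at
  \<open>t = 1\<close> then gives the missing inequality
  \<open>h x + h y \<le> h (x + y)\<close>.\<close>

lemma minimal_sublinear_imp_linear:
  assumes h: "sublinear sc h"
    and min: "\<And>g. sublinear sc g \<Longrightarrow> g \<le> h \<Longrightarrow> g = h"
  shows "Vector_Spaces.linear sc (*) h"
proof -
  have add: "h (x + y) = h x + h y" for x y
  proof -
    have "slope h y \<le> h"
      using slope_le[OF h, of 0 y] by (simp add: le_fun_def)
    then have "slope h y = h" by (intro min sublinear_slope h)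
    then have "h x \<le> h (x + y) - h y"
      using slope_le[OF h, of 1 y x] by simp
    moreover have "h (x + y) \<le> h x + h y" using h by (simp add: sublinear_def)
    ultimately show ?thesis by simp
  qed
  have neg: "h (- x) = - h x" for x
    using add[of x "- x"] sublinear_zero[OF h] by simp
  have hom: "h (sc r x) = r * h x" for r x
  proof (cases "r \<ge> 0")
    case False
    then have "0 \<le> - r" by simp
    then have "h (sc (- r) x) = - r * h x" using h unfolding sublinear_def by blast
    then show ?thesis using neg[of "sc r x"] by simp
  qed (use h in \<open>simp add: sublinear_def\<close>)
  show ?thesis
    by unfold_locales (simp_all add: add hom algebra_simps)
qed

text \<open>Passing to the slope of \<open>p\<close> along \<open>y\<close> before minimizing forces \<open>g y = p y\<close>.\<close>

lemma hahn_banach_sublinear: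
  assumes p: "sublinear sc p"
  obtains g where "Vector_Spaces.linear sc (*) g" "g \<le> p" "g y = p y"
proof -
  obtain g where g: "sublinear sc g" "g \<le> slope p y"
      "\<And>f. sublinear sc f \<Longrightarrow> f \<le> g \<Longrightarrow> f = g"
    using minimal_sublinear_exists[OF sublinear_slope[OF p]] by metis
  have lin: "Vector_Spaces.linear sc (*) g"
    using g(1,3) by (rule minimal_sublinear_imp_linear)
  have "slope p y \<le> p"
    using slope_le[OF p, of 0 y] by (simp add: le_fun_def)
  then have gp: "g \<le> p" using g(2) by simp
  \<comment> \<open>At \<open>x = - y\<close> the term with \<open>t = 1\<close> is
    \<open>p 0 - p y\<close>. This upper bound on \<open>g (- y)\<close> becomes
    \<open>p y \<le> g y\<close> by linearity.\<close>
  have "slope p y (- y) \<le> - p y"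
    using slope_le[OF p, of 1 y "- y"] sublinear_zero[OF p] by simp
  then have "- g y \<le> - p y"
    using le_funD[OF g(2), of "- y"] module_hom.neg[of sc "(*)" g y] lin
    by (simp add: Vector_Spaces.linear_def)
  then have "g y = p y" using le_funD[OF gp, of y] by simp
  with lin gp show thesis by (rule that)
qed

end

section \<open>Continuous seminorms\<close>

lemma dist_seminorm_le:
  fixes p :: "'a::ab_group_add \<Rightarrow> real"
  assumes add: "\<And>x y. p (x + y) \<le> p x + p y" and neg: "\<And>x. p (- x) = p x"
  shows "dist (p x) (p y) \<le> p (x - y)"
proof -
  have "p x \<le> p (x - y) + p y" "p y \<le> p (y - x) + p x"
    using add[of "x - y" y] add[of "y - x" x] by simp_all
  moreover have "p (y - x) = p (x - y)"
    using neg[of "x - y"] by simp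
  ultimately show ?thesis by (simp add: dist_real_def abs_le_iff)
qed

lemma eventually_nhds_translate:
  fixes x :: "'a::topological_ab_group_add"
  assumes "\<forall>\<^sub>F z in nhds 0. P z"
  shows "\<forall>\<^sub>F y in nhds x. P (y - x)"
proof -
  have "((\<lambda>y. y - x) \<longlongrightarrow> x - x) (nhds x)"
    by (intro tendsto_intros filterlim_ident)
  then show ?thesis
    using assms by (simp add: filterlim_iff)
qed

text \<open>Smallness near 0 gives \<open>p 0 = 0\<close> and, by the reverse triangle inequality
  and translation, continuity everywhere. The scaling inequality becomes an equality when applied to
  \<open>inverse c\<close>.\<close>

lemma continuous_seminormI:
  fixes smul :: "'k::real_normed_field \<Rightarrow> 'a::topological_ab_group_add \<Rightarrow> 'a"
  assumes vs: "vector_space smul"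
    and nonneg: "\<And>x. 0 \<le> p x"
    and add: "\<And>x y. p (x + y) \<le> p x + p y"
    and hom_le: "\<And>c x. c \<noteq> 0 \<Longrightarrow> p (smul c x) \<le> norm c * p x"
    and cont: "\<And>e. e > 0 \<Longrightarrow> \<forall>\<^sub>F z in nhds 0. p z < e"
  shows "continuous_seminorm smul p"
proof -
  interpret vector_space smul by (fact vs)
  have zero: "p 0 = 0"
  proof (rule antisym[OF _ nonneg], rule field_le_epsilon)
    fix e :: real assume "e > 0"
    then show "p 0 \<le> 0 + e" using eventually_nhds_x_imp_x[OF cont] by fastforce
  qed
  have hom: "p (smul c x) = norm c * p x" for c x
  proof (cases "c = 0")
    case False
    have "p x \<le> norm (inverse c) * p (smul c x)"
      using hom_le[of "inverse c" "smul c x"] False by simp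
    then have "norm c * p x \<le> p (smul c x)"
      using False by (simp add: norm_inverse norm_divide field_simps)
    then show ?thesis using hom_le[OF False, of x] by simp
  qed (simp add: zero)
  have neg: "p (- x) = p x" for x
    using hom[of "-1" x] by simp
  have "continuous_on UNIV p"
    unfolding continuous_on_def
  proof (intro ballI tendstoI)
    fix x and e :: real assume "e > 0"
    then have "\<forall>\<^sub>F y in nhds x. p (y - x) < e"
      using cont eventually_nhds_translate[of "\<lambda>z. p z < e"] by blast
    then have "\<forall>\<^sub>F y in nhds x. dist (p y) (p x) < e"
      by eventually_elim (use dist_seminorm_le[of p, OF add neg] in \<open>auto intro: le_less_trans\<close>)
    then show "\<forall>\<^sub>F y in at x within UNIV. dist (p y) (p x) < e"
      by (simp add: eventually_nhds_conv_at)
  qed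
  then show ?thesis
    using nonneg add hom by (simp add: continuous_seminorm_def)
qed

context
  fixes smul :: "'k::real_normed_field \<Rightarrow> 'a::topological_ab_group_add \<Rightarrow> 'a" and p
  assumes p: "continuous_seminorm smul p"
begin

lemma seminorm_nonneg: "0 \<le> p x"
  using p by (simp add: continuous_seminorm_def)

lemma seminorm_add: "p (x + y) \<le> p x + p y"
  using p by (simp add: continuous_seminorm_def)

lemma seminorm_scale: "p (smul c x) = norm c * p x"
  using p by (simp add: continuous_seminorm_def)

lemma seminorm_continuous: "continuous_on A p"
  using p continuous_on_subset by (auto simp: continuous_seminorm_def)

lemma seminorm_zero:
  assumes "vector_space smul"
  shows "p 0 = 0"
proof -
  interpret vector_space smul by (fact assms)
  show ?thesis using seminorm_scale[of 0 0] by simp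
qed

lemma seminorm_minus:
  assumes "vector_space smul"
  shows "p (- x) = p x"
proof -
  interpret vector_space smul by (fact assms)
  show ?thesis using seminorm_scale[of "-1" x] by simp
qed

lemma seminorm_tendsto_zero:
  assumes "vector_space smul" "(f \<longlongrightarrow> l) F"
  shows "((\<lambda>t. p (f t - l)) \<longlongrightarrow> 0) F"
proof -
  have "((\<lambda>t. f t - l) \<longlongrightarrow> l - l) F"
    using assms(2) by (intro tendsto_intros)
  then have "((\<lambda>t. p (f t - l)) \<longlongrightarrow> p (l - l)) F"
    by (rule continuous_on_UNIV_tendsto[OF seminorm_continuous])
  then show ?thesis using assms(1) by (simp add: seminorm_zero)
qed

end

section \<open>Minkowski functionals and the topology given by seminorms\<close>

context locally_convex_space
begin

lemma continuous_on_smul [continuous_intros]: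
  assumes "continuous_on A f" "continuous_on A g"
  shows "continuous_on A (\<lambda>x. smul (f x) (g x))"
  using continuous_on_compose2[OF continuous_scale continuous_on_Pair[OF assms]] by simp

lemma eventually_smul_nhds_zero:
  assumes "\<forall>\<^sub>F z in nhds 0. P z"
  shows "\<forall>\<^sub>F z in nhds 0. P (smul c z)"
proof -
  have "continuous_on UNIV (smul c)"
    by (intro continuous_intros)
  then have "(smul c \<longlongrightarrow> smul c 0) (nhds 0)"
    using continuous_on_UNIV_tendsto filterlim_ident by blast
  then show ?thesis using assms by (simp add: filterlim_iff)
qed

text \<open>The balanced core of a convex neighbourhood \<open>V\<close> stays convex, and joint
  continuity of scaling at \<open>(0, 0)\<close> keeps it a neighbourhood of 0.\<close>

lemma balanced_convex_nhds_zero: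
  assumes "open U" "0 \<in> U"
  obtains B where "convex_wrt smul B" "\<forall>\<^sub>F x in nhds 0. x \<in> B" "B \<subseteq> U"
    "\<And>c x. norm c \<le> 1 \<Longrightarrow> x \<in> B \<Longrightarrow> smul c x \<in> B"
proof -
  obtain V where V: "convex_wrt smul V" "0 \<in> interior V" "V \<subseteq> U"
    using convex_nhds_zero[OF assms] by blast
  define B where "B = {x. \<forall>c. norm c \<le> 1 \<longrightarrow> smul c x \<in> V}"
  have "convex_wrt smul B"
    unfolding convex_wrt_def
  proof (intro ballI allI impI)
    fix x y and u v :: real
    assume xy: "x \<in> B" "y \<in> B" and uv: "0 \<le> u" "0 \<le> v" "u + v = 1"
    show "smul (of_real u) x + smul (of_real v) y \<in> B"
      unfolding B_def
    proof (intro CollectI allI impI)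
      fix c :: 'k assume "norm c \<le> 1"
      then have "smul (of_real u) (smul c x) + smul (of_real v) (smul c y) \<in> V"
        using V(1) xy uv by (simp add: convex_wrt_def B_def del: scale_scale)
      then show "smul c (smul (of_real u) x + smul (of_real v) y) \<in> V"
        by (simp add: scale_right_distrib mult.commute)
    qed
  qed
  moreover have "\<forall>\<^sub>F x in nhds 0. x \<in> B"
  proof -
    have "((\<lambda>(c, x). smul c x) \<longlongrightarrow> (\<lambda>(c, x). smul c x) (0, 0)) (nhds 0 \<times>\<^sub>F nhds 0)"
      by (rule continuous_on_UNIV_tendsto[OF continuous_scale]) (simp add: nhds_prod filterlim_ident)
    then have "((\<lambda>(c, x). smul c x) \<longlongrightarrow> smul 0 0) (nhds 0 \<times>\<^sub>F nhds 0)"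
      by simp
    moreover have "\<forall>\<^sub>F z in nhds (smul 0 0). z \<in> interior V"
      using V(2) by (intro eventually_nhds_in_open) auto
    ultimately have "\<forall>\<^sub>F cx in nhds 0 \<times>\<^sub>F nhds 0. smul (fst cx) (snd cx) \<in> interior V"
      by (auto simp: filterlim_iff split_beta)
    then obtain P Q where P: "eventually P (nhds (0::'k))" and Q: "eventually Q (nhds (0::'a))"
        and PQ: "\<And>c x. P c \<Longrightarrow> Q x \<Longrightarrow> smul c x \<in> interior V"
      unfolding eventually_prod_filter by auto
    obtain d where d: "d > 0" "\<And>c. norm c < d \<Longrightarrow> P c"
      using P by (auto simp: eventually_nhds_metric)
    \<comment> \<open>A scalar \<open>c\<close> of norm at most 1 factors as
      \<open>c * (d / 2)\<close>, which has norm below \<open>d\<close>, times \<open>2 / d\<close>,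
      which is absorbed into the neighbourhood of \<open>x\<close>.\<close>
    have "\<forall>\<^sub>F x in nhds 0. Q (smul (of_real (2 / d)) x)"
      using Q by (rule eventually_smul_nhds_zero)
    then show ?thesis
    proof eventually_elim
      case (elim x)
      show ?case
        unfolding B_def
      proof (intro CollectI allI impI)
        fix c :: 'k assume c: "norm c \<le> 1"
        have "norm (c * of_real (d / 2)) < d"
          using c d(1) by (simp add: norm_mult)
        then have "smul (c * of_real (d / 2)) (smul (of_real (2 / d)) x) \<in> interior V"
          using d(2) elim PQ by blast
        moreover have "c * of_real (d / 2) * of_real (2 / d) = c"
          using d(1) by (simp flip: of_real_mult add: mult.assoc)
        ultimately show "smul c x \<in> V"
          using interior_subset by auto
      qed
    qed
  qed
  moreover have "B \<subseteq> U"
  proof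
    fix x assume "x \<in> B"
    then have "smul 1 x \<in> V" unfolding B_def by (metis (mono_tags) mem_Collect_eq norm_one order_refl)
    then show "x \<in> U" using V(3) by auto
  qed
  moreover have "smul c x \<in> B" if c: "norm c \<le> 1" and x: "x \<in> B" for c x
    unfolding B_def
  proof (intro CollectI allI impI)
    fix b :: 'k assume "norm b \<le> 1"
    then have "norm (b * c) \<le> 1" using c by (simp add: norm_mult mult_le_one)
    then show "smul b (smul c x) \<in> V" using x by (simp add: B_def)
  qed
  ultimately show thesis by (rule that)
qed

text \<open>The seminorm is the Minkowski functional of a balanced convex neighbourhood
  \<open>B\<close>: convexity gives subadditivity, balancedness gives absolute homogeneity, and
  being a neighbourhood gives finiteness and continuity.\<close>

lemma continuous_seminorm_in_nhds_zero:
  assumes "open U" "0 \<in> U"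
  obtains p where "continuous_seminorm smul p" "\<And>x. p x < 1 \<Longrightarrow> x \<in> U"
proof -
  obtain B where convex: "convex_wrt smul B" and nhds: "\<forall>\<^sub>F x in nhds 0. x \<in> B" and BU: "B \<subseteq> U"
    and bal: "\<And>c x. norm c \<le> 1 \<Longrightarrow> x \<in> B \<Longrightarrow> smul c x \<in> B"
    using balanced_convex_nhds_zero[OF assms] by metis
  \<comment> \<open>These are the dilation factors \<open>r > 0\<close> for which \<open>x\<close>
    lies in \<open>r\<close> times \<open>B\<close>.\<close>
  define R where "R x = {r. r > 0 \<and> smul (of_real (inverse r)) x \<in> B}" for x
  define p where "p x = Inf (R x)" for x
  have bdd: "bdd_below (R x)" for x
    by (rule bdd_belowI[of _ 0]) (simp add: R_def)
  have ne: "R x \<noteq> {}" for x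
  proof -
    have "continuous_on UNIV (\<lambda>c. smul c x)"
      by (intro continuous_intros)
    then have "((\<lambda>c. smul c x) \<longlongrightarrow> smul 0 x) (nhds 0)"
      using continuous_on_UNIV_tendsto filterlim_ident by blast
    then have "\<forall>\<^sub>F c in nhds 0. smul c x \<in> B"
      using nhds eventually_compose_filterlim[of "\<lambda>x. x \<in> B"] by simp
    then obtain d where d: "d > 0" "\<And>c. norm c < d \<Longrightarrow> smul c x \<in> B"
      by (auto simp: eventually_nhds_metric)
    have "2 / d \<in> R x"
      using d by (simp add: R_def norm_divide)
    then show ?thesis by blast
  qed
  have le: "p x \<le> r" if "r > 0" "smul (of_real (inverse r)) x \<in> B" for x r
    unfolding p_def using that by (intro cInf_lower bdd) (simp add: R_def)
  have less: "\<exists>r. 0 < r \<and> r < a \<and> smul (of_real (inverse r)) x \<in> B" if "p x < a" for x a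
    using that cInf_lessD[OF ne] unfolding p_def by (auto simp: R_def)
  have nonneg: "0 \<le> p x" for x
    unfolding p_def using ne by (intro cInf_greatest) (auto simp: R_def)
  have add: "p (x + y) \<le> p x + p y" for x y
  proof (rule field_le_epsilon)
    fix e :: real assume "e > 0"
    obtain r where r: "0 < r" "r < p x + e / 2" "smul (of_real (inverse r)) x \<in> B"
      using less[of x "p x + e / 2"] \<open>e > 0\<close> by auto
    obtain s where s: "0 < s" "s < p y + e / 2" "smul (of_real (inverse s)) y \<in> B"
      using less[of y "p y + e / 2"] \<open>e > 0\<close> by auto
    \<comment> \<open>The weights make this convex combination equal to \<open>x + y\<close> divided
      by \<open>r + s\<close>.\<close>
    have "smul (of_real (r / (r + s))) (smul (of_real (inverse r)) x) +
        smul (of_real (s / (r + s))) (smul (of_real (inverse s)) y) \<in> B"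
      using convex r s unfolding convex_wrt_def
      by (auto simp: add_divide_distrib[symmetric] simp del: scale_scale of_real_divide of_real_inverse)
    also have "smul (of_real (r / (r + s))) (smul (of_real (inverse r)) x) +
        smul (of_real (s / (r + s))) (smul (of_real (inverse s)) y) = smul (of_real (inverse (r + s))) (x + y)"
    proof -
      have "r / (r + s) * inverse r = inverse (r + s)" "s / (r + s) * inverse s = inverse (r + s)"
        using r s by (simp_all add: field_simps)
      then show ?thesis
        by (simp add: scale_right_distrib flip: of_real_mult del: of_real_divide of_real_inverse)
    qed
    finally have "p (x + y) \<le> r + s" using r s by (intro le) auto
    then show "p (x + y) \<le> p x + p y + e" using r s by simp
  qed
  have hom_le: "p (smul c x) \<le> norm c * p x" if c: "c \<noteq> 0" for c x
  proof -
    have "p (smul c x) / norm c \<le> p x"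
      unfolding p_def[of x]
    proof (rule cInf_greatest[OF ne])
      fix r assume "r \<in> R x"
      then have r: "r > 0" "smul (of_real (inverse r)) x \<in> B" by (auto simp: R_def)
      \<comment> \<open>The factor \<open>c / of_real (norm c)\<close> has norm 1, so balancedness
        absorbs it and only the dilation by \<open>norm c\<close> remains.\<close>
      have "smul (c / of_real (norm c)) (smul (of_real (inverse r)) x) \<in> B"
        by (rule bal[OF _ r(2)]) (simp add: norm_divide)
      then have "smul (of_real (inverse (norm c * r))) (smul c x) \<in> B"
        by (simp add: divide_inverse mult_ac)
      then have "p (smul c x) \<le> norm c * r"
        using r c by (intro le) auto
      then show "p (smul c x) / norm c \<le> r"
        using c by (simp add: field_simps)
    qed
    then show ?thesis using c by (simp add: field_simps)
  qed
  have small: "\<forall>\<^sub>F z in nhds 0. p z < e" if "e > 0" for e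
  proof -
    have "\<forall>\<^sub>F z in nhds 0. smul (of_real (inverse (e / 2))) z \<in> B"
      using nhds by (rule eventually_smul_nhds_zero)
    then show ?thesis
    proof eventually_elim
      case (elim z)
      then have "p z \<le> e / 2" using that by (intro le) simp_all
      then show ?case using that by simp
    qed
  qed
  have "continuous_seminorm smul p"
    using vector_space_axioms nonneg add hom_le small by (rule continuous_seminormI)
  moreover have "x \<in> U" if px: "p x < 1" for x
  proof -
    obtain r where r: "0 < r" "r < 1" "smul (of_real (inverse r)) x \<in> B"
      using less[OF px] by blast
    have "norm (of_real r :: 'k) \<le> 1" using r by simp
    then have "smul (of_real r) (smul (of_real (inverse r)) x) \<in> B"
      using r(3) by (rule bal)
    then show ?thesis using r BU by auto
  qed
  ultimately show thesis by (rule that)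
qed

text \<open>Every neighbourhood of 0 contains the open unit ball of a continuous seminorm, so after
  translation by \<open>l\<close> the seminorms detect convergence.\<close>

lemma tendsto_seminormI:
  assumes "\<And>p. continuous_seminorm smul p \<Longrightarrow> ((\<lambda>t. p (f t - l)) \<longlongrightarrow> 0) F"
  shows "(f \<longlongrightarrow> l) F"
proof (rule topological_tendstoI)
  fix S assume S: "open S" "l \<in> S"
  have "open ((\<lambda>x. x + l) -` S)"
    using S(1) by (intro open_vimage continuous_intros)
  then obtain p where p: "continuous_seminorm smul p" "\<And>x. p x < 1 \<Longrightarrow> x + l \<in> S"
    using continuous_seminorm_in_nhds_zero[of "(\<lambda>x. x + l) -` S"] S(2) by auto
  have "\<forall>\<^sub>F t in F. p (f t - l) < 1"
    using assms[OF p(1)] by (rule order_tendstoD) simp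
  then show "\<forall>\<^sub>F t in F. f t \<in> S"
    by eventually_elim (use p(2) in force)
qed

end

section \<open>Hahn-Banach for seminorms over the scalar field\<close>

text \<open>
  The real-linear form \<open>\<lambda>c. inner 1 c\<close> plays the role of the real part: it fixes \<open>of_real r\<close>, and
  \<open>a \<mapsto> (\<lambda>c. inner 1 (c * a))\<close> is an isomorphism onto the real-linear forms of the field.
\<close>

lemma inner_one_of_real: "inner (1::'k::{real_normed_field, euclidean_space}) (of_real r) = r"
  by (simp add: of_real_def dot_square_norm)

text \<open>If \<open>a\<close> and \<open>b\<close> differed, the scalar
  \<open>inverse (a - b)\<close> would separate the two forms by
  \<open>inner 1 1 = 1\<close>.\<close>

lemma inner_one_mult_eqD:
  fixes a b :: "'k::{real_normed_field, euclidean_space}"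
  assumes "\<And>c. inner 1 (c * a) = inner 1 (c * b)"
  shows "a = b"
proof (rule ccontr)
  assume "a \<noteq> b"
  then have "inner 1 (inverse (a - b) * a) - inner 1 (inverse (a - b) * b) = 1"
    using inner_one_of_real[of 1, where 'k = 'k]
    by (simp flip: inner_diff_right right_diff_distrib)
  then show False using assms by simp
qed

text \<open>The form belonging to \<open>a\<close> is represented by the vector \<open>J a\<close>.
  The linear map \<open>J\<close> is injective on a finite-dimensional space, hence
  surjective.\<close>

lemma inner_one_mult_surj:
  fixes h :: "'k::{real_normed_field, euclidean_space} \<Rightarrow> real"
  assumes h: "linear h"
  obtains a where "\<And>c. h c = inner 1 (c * a)"
proof -
  define J where "J a = (\<Sum>b\<in>Basis. inner 1 (b * a) *\<^sub>R b)" for a :: 'k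
  have repr: "g c = inner c (\<Sum>b\<in>Basis. g b *\<^sub>R b)" if "linear g" for g :: "'k \<Rightarrow> real" and c
  proof -
    have "g c = g (\<Sum>b\<in>Basis. inner c b *\<^sub>R b)" by (simp add: euclidean_representation)
    also have "\<dots> = (\<Sum>b\<in>Basis. inner c b * g b)"
      using that by (simp add: linear_sum linear_cmul)
    finally show ?thesis by (simp add: inner_sum_right mult.commute)
  qed
  have J: "inner 1 (c * a) = inner c (J a)" for a c
    unfolding J_def
    by (rule repr) (auto intro!: linearI simp: distrib_right inner_add_right)
  have "linear J"
    unfolding J_def
    by (auto intro!: linearI simp: distrib_left inner_add_right scaleR_left_distrib sum.distrib scaleR_sum_right)
  moreover have "inj J"
    by (rule injI, rule inner_one_mult_eqD) (simp add: J)
  ultimately have "surj J"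
    by (rule linear_inj_imp_surj)
  then obtain a where "J a = (\<Sum>b\<in>Basis. h b *\<^sub>R b)"
    by (metis surjD)
  then have "h c = inner 1 (c * a)" for c
    using repr[OF h, of c] by (simp add: J)
  then show thesis by (rule that)
qed

lemma vector_space_of_real:
  fixes s :: "'k::real_normed_field \<Rightarrow> 'v::ab_group_add \<Rightarrow> 'v"
  assumes "vector_space s"
  shows "vector_space (\<lambda>r. s (of_real r))"
proof -
  interpret s: vector_space s by (fact assms)
  show ?thesis
    by unfold_locales (simp_all add: s.scale_right_distrib s.scale_left_distrib)
qed

text \<open>A real-linear \<open>g\<close> dominated by \<open>p\<close> is the real part of a
  scalar-linear \<open>f\<close>: for fixed \<open>x\<close> the form
  \<open>c \<mapsto> g (smul c x)\<close> is \<open>inner 1 (c * f x)\<close> for a unique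
  \<open>f x\<close>.\<close>

lemma hahn_banach_seminorm:
  fixes smul :: "'k::{real_normed_field, euclidean_space} \<Rightarrow> 'a::ab_group_add \<Rightarrow> 'a"
  assumes vs: "vector_space smul"
    and add: "\<And>x y. p (x + y) \<le> p x + p y"
    and hom: "\<And>c x. p (smul c x) = norm c * p x"
  obtains f where "Vector_Spaces.linear smul (*) f" "\<And>x. norm (f x) \<le> p x" "norm (f y) = p y"
proof -
  interpret vector_space smul by (fact vs)
  let ?sc = "\<lambda>r. smul (of_real r)"
  have vsr: "vector_space ?sc"
    by (rule vector_space_of_real[OF vs])
  have "sublinear ?sc p"
    using add hom by (simp add: sublinear_def)
  then obtain g where g: "Vector_Spaces.linear ?sc (*) g" "g \<le> p" "g y = p y"
    using hahn_banach_sublinear[OF vsr] by metis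
  interpret g: Vector_Spaces.linear ?sc "(*)" g by (fact g(1))
  have "\<exists>a. \<forall>c. g (smul c x) = inner 1 (c * a)" for x
  proof -
    have "linear (\<lambda>c. g (smul c x))"
      by (rule linearI)
         (simp_all add: scale_left_distrib g.add scaleR_conv_of_real g.scale flip: scale_scale)
    then show ?thesis by (metis inner_one_mult_surj)
  qed
  then obtain f where f: "\<And>x c. g (smul c x) = inner 1 (c * f x)"
    by metis
  \<comment> \<open>Uniqueness of the representing scalar carries additivity and homogeneity over to
    \<open>f\<close>.\<close>
  have lin: "Vector_Spaces.linear smul (*) f"
  proof unfold_locales
    show "f (u + v) = f u + f v" for u v
      by (rule inner_one_mult_eqD)
         (simp add: distrib_left inner_add_right scale_right_distrib g.add flip: f)
    show "f (smul b u) = b * f u" for b u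
      by (rule inner_one_mult_eqD) (simp flip: f mult.assoc)
  qed
  have bound: "norm (f x) \<le> p x" for x
  proof (cases "f x = 0")
    case True
    have "0 \<le> p x"
      using add[of x "- x"] hom[of "-1" x] hom[of 0 0] by simp
    then show ?thesis using True by simp
  next
    case False
    \<comment> \<open>This scalar of norm 1 rotates \<open>f x\<close> onto the nonnegative real
      \<open>norm (f x)\<close>, where \<open>g\<close> can be compared with
      \<open>p\<close>.\<close>
    define c where "c = of_real (norm (f x)) / f x"
    have "norm (f x) = inner 1 (c * f x)"
      using False by (simp add: c_def inner_one_of_real)
    also have "\<dots> = g (smul c x)" by (simp add: f)
    also have "\<dots> \<le> p (smul c x)" using g(2) by (rule le_funD)
    also have "\<dots> = p x" using False by (simp add: hom c_def norm_divide)
    finally show ?thesis .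
  qed
  have "p y = inner 1 (f y)"
    using f[of 1 y] g(3) by simp
  also have "\<dots> \<le> norm (f y)"
    using norm_cauchy_schwarz[of 1 "f y"] by simp
  finally have "norm (f y) = p y" using bound[of y] by simp
  with lin bound show thesis by (rule that)
qed

section \<open>Banach-Alaoglu and the weak-star topology\<close>

text \<open>By Tychonoff the product of the closed balls of radius \<open>p x\<close> is compact,
  and linearity and the bound are closed conditions on finitely many coordinates at a time.\<close>

lemma compact_linear_forms_le:
  fixes smul :: "'k::{real_normed_field, euclidean_space} \<Rightarrow> 'a::ab_group_add \<Rightarrow> 'a"
  assumes "vector_space smul"
  shows "compact {f. Vector_Spaces.linear smul (*) f \<and> (\<forall>x. norm (f x) \<le> p x)}"
proof -
  interpret vector_space smul by (fact assms)
  let ?U = "{f. Vector_Spaces.linear smul (*) f \<and> (\<forall>x. norm (f x) \<le> p x)}"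
  have lin: "Vector_Spaces.linear smul (*) f \<longleftrightarrow>
      (\<forall>x y. f (x + y) = f x + f y) \<and> (\<forall>c x. f (smul c x) = c * f x)" for f :: "'a \<Rightarrow> 'k"
  proof
    assume "Vector_Spaces.linear smul (*) f"
    then interpret f: Vector_Spaces.linear smul "(*)" f .
    show "(\<forall>x y. f (x + y) = f x + f y) \<and> (\<forall>c x. f (smul c x) = c * f x)"
      by (simp add: f.add f.scale)
  qed (unfold_locales, auto simp: algebra_simps)
  have "compactin (product_topology (\<lambda>_. euclidean) UNIV) (\<Pi>\<^sub>E x\<in>UNIV. cball (0::'k) (p x))"
    by (simp add: compactin_PiE compactin_euclidean_iff)
  then have "compact (\<Pi>\<^sub>E x\<in>UNIV. cball (0::'k) (p x))"
    by (simp add: euclidean_product_topology)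
  moreover have "closed ?U"
  proof -
    have "?U = (\<Inter>x y. {f. f (x + y) = f x + f y}) \<inter> (\<Inter>c x. {f. f (smul c x) = c * f x}) \<inter>
        (\<Inter>x. {f. norm (f x) \<le> p x})"
      unfolding lin by auto
    also have "closed \<dots>"
      by (intro closed_Int closed_INT ballI closed_Collect_eq closed_Collect_le continuous_intros
          continuous_on_product_coordinates)
    finally show ?thesis .
  qed
  ultimately have "compact ((\<Pi>\<^sub>E x\<in>UNIV. cball (0::'k) (p x)) \<inter> ?U)"
    by (rule compact_Int_closed)
  also have "(\<Pi>\<^sub>E x\<in>UNIV. cball (0::'k) (p x)) \<inter> ?U = ?U"
    by auto
  finally show ?thesis .
qed

lemma (in locally_convex_space) linear_le_seminorm_in_dual:
  assumes f: "Vector_Spaces.linear smul (*) f" and p: "continuous_seminorm smul p"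
    and le: "\<And>x. norm (f x) \<le> p x"
  shows "f \<in> continuous_dual smul"
proof -
  interpret f: Vector_Spaces.linear smul "(*)" f by (fact f)
  have "continuous_on UNIV f"
    unfolding continuous_on_def
  proof
    fix x
    have "((\<lambda>y. p (y - x)) \<longlongrightarrow> 0) (at x)"
      by (rule seminorm_tendsto_zero[OF p vector_space_axioms tendsto_ident_at])
    then have "((\<lambda>y. f y - f x) \<longlongrightarrow> 0) (at x)"
      by (rule Lim_null_comparison[rotated]) (simp add: le flip: f.diff)
    then show "(f \<longlongrightarrow> f x) (at x)"
      by (simp add: LIM_zero_iff)
  qed
  with f show ?thesis by (simp add: continuous_dual_def)
qed

lemma continuous_map_weak_star:
  assumes "\<And>z. z \<in> S \<Longrightarrow> \<Phi> z \<in> continuous_dual smul"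
    and "\<And>x. continuous_on S (\<lambda>z. \<Phi> z x)"
  shows "continuous_map (top_of_set S) (weak_star_topology smul) \<Phi>"
  unfolding weak_star_topology_def
proof (rule continuous_on_generated_topo)
  fix W assume "W \<in> {{f \<in> continuous_dual smul. f x \<in> U} | x U. open U}"
  then obtain x U where W: "W = {f \<in> continuous_dual smul. f x \<in> U}" "open U" by blast
  have "\<Phi> -` W \<inter> topspace (top_of_set S) = S \<inter> (\<lambda>z. \<Phi> z x) -` U"
    using assms(1) by (auto simp: W(1))
  then show "openin (top_of_set S) (\<Phi> -` W \<inter> topspace (top_of_set S))"
    using assms(2) W(2) by (simp add: continuous_openin_preimage_gen)
next
  \<comment> \<open>Taking \<open>U = UNIV\<close> shows that the whole dual is a generating set, so
    the generating sets cover the image.\<close>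
  have "continuous_dual smul \<in> {{f \<in> continuous_dual smul. f x \<in> U} | x U. open U}"
    by (intro CollectI exI[of _ undefined] exI[of _ UNIV]) simp
  then have "continuous_dual smul \<subseteq> \<Union> {{f \<in> continuous_dual smul. f x \<in> U} | x U. open U}"
    by (rule Union_upper)
  moreover have "\<Phi> ` topspace (top_of_set S) \<subseteq> continuous_dual smul"
    using assms(1) by auto
  ultimately show "\<Phi> ` topspace (top_of_set S) \<subseteq>
      \<Union> {{f \<in> continuous_dual smul. f x \<in> U} | x U. open U}"
    by (rule order_trans[rotated])
qed

section \<open>Equicontinuity from the strong Mackey property\<close>

lemma (in strong_mackey_space) strongly_continuous_family_equicontinuous:
  fixes S :: "'s::topological_space set"
  assumes S: "compact S"
    and lin: "\<And>s. s \<in> S \<Longrightarrow> Vector_Spaces.linear smul smul (T s)"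
    and cont: "\<And>s. s \<in> S \<Longrightarrow> continuous_on UNIV (T s)"
    and orbit: "\<And>x. continuous_on S (\<lambda>s. T s x)"
    and p: "continuous_seminorm smul p"
  obtains q where "continuous_seminorm smul q" "\<And>s x. s \<in> S \<Longrightarrow> p (T s x) \<le> q x"
proof (cases "S = {}")
  \<comment> \<open>A supremum over the empty set of reals is unspecified, so the zero seminorm is
    used here.\<close>
  case True
  have "continuous_seminorm smul (\<lambda>_. 0)"
    by (simp add: continuous_seminorm_def)
  then show thesis using True by (intro that) auto
next
  case False
  define U where "U = {f. Vector_Spaces.linear smul (*) f \<and> (\<forall>x. norm (f x) \<le> p x)}"
  define \<Phi> where "\<Phi> z = snd z \<circ> T (fst z)" for z :: "'s \<times> ('a \<Rightarrow> 'k)"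
  have "\<Phi> z \<in> continuous_dual smul" if "z \<in> S \<times> U" for z
  proof -
    have "snd z \<in> continuous_dual smul"
      using that by (intro linear_le_seminorm_in_dual[OF _ p]) (auto simp: U_def)
    then show ?thesis
      using that lin[of "fst z"] cont[of "fst z"]
      by (auto simp: \<Phi>_def continuous_dual_def intro: Vector_Spaces.linear_compose
          continuous_on_compose2[of UNIV])
  qed
  moreover have "continuous_on (S \<times> U) (\<lambda>z. \<Phi> z x)" for x
    unfolding continuous_on_def
  proof
    fix z0 assume z0: "z0 \<in> S \<times> U"
    define F where "F = at z0 within S \<times> U"
    have F: "\<forall>\<^sub>F z in F. z \<in> S \<times> U"
      unfolding F_def by (simp add: eventually_at_filter)
    have fst: "(fst \<longlongrightarrow> fst z0) F" and snd: "(snd \<longlongrightarrow> snd z0) F"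
      unfolding F_def by (auto intro!: tendsto_intros)
    \<comment> \<open>With \<open>?y\<close> as intermediate point, the increment
      \<open>snd z (T (fst z) x) - snd z ?y\<close> is bounded by
      \<open>p (T (fst z) x - ?y)\<close> uniformly over \<open>U\<close>, while
      \<open>snd z ?y\<close> is a coordinate evaluation.\<close>
    let ?y = "T (fst z0) x"
    have "((\<lambda>z. T (fst z) x) \<longlongrightarrow> ?y) F"
      using z0 F by (intro continuous_on_tendsto_compose[OF orbit fst]) (auto elim: eventually_mono)
    then have "((\<lambda>z. p (T (fst z) x - ?y)) \<longlongrightarrow> 0) F"
      by (rule seminorm_tendsto_zero[OF p vector_space_axioms])
    then have "((\<lambda>z. snd z (T (fst z) x) - snd z ?y) \<longlongrightarrow> 0) F"
    proof (rule Lim_null_comparison[rotated])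
      show "\<forall>\<^sub>F z in F. norm (snd z (T (fst z) x) - snd z ?y) \<le> p (T (fst z) x - ?y)"
        using F
      proof eventually_elim
        case (elim z)
        then interpret f: Vector_Spaces.linear smul "(*)" "snd z" by (auto simp: U_def)
        show ?case using elim by (auto simp: U_def simp flip: f.diff)
      qed
    qed
    moreover have "((\<lambda>z. snd z ?y) \<longlongrightarrow> snd z0 ?y) F"
      by (rule continuous_on_UNIV_tendsto[OF continuous_on_product_coordinates snd])
    ultimately have "((\<lambda>z. snd z (T (fst z) x) - snd z ?y + snd z ?y) \<longlongrightarrow> 0 + snd z0 ?y) F"
      by (rule tendsto_add)
    then show "((\<lambda>z. \<Phi> z x) \<longlongrightarrow> \<Phi> z0 x) (at z0 within S \<times> U)"
      by (simp add: \<Phi>_def F_def)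
  qed
  ultimately have "continuous_map (top_of_set (S \<times> U)) (weak_star_topology smul) \<Phi>"
    by (rule continuous_map_weak_star)
  moreover have "compactin (top_of_set (S \<times> U)) (S \<times> U)"
    using compact_Times[OF S compact_linear_forms_le[OF vector_space_axioms, of p]]
    by (simp add: U_def compactin_subtopology)
  ultimately have "compactin (weak_star_topology smul) (\<Phi> ` (S \<times> U))"
    by (rule image_compactin[rotated])
  then have equi: "equicontinuous (\<Phi> ` (S \<times> U))"
    by (rule strong_mackey)
  define q where "q x = (SUP s\<in>S. p (T s x))" for x
  have bdd: "bdd_above ((\<lambda>s. p (T s x)) ` S)" for x
  proof -
    have "continuous_on S (\<lambda>s. p (T s x))"
      by (rule continuous_on_compose2[OF seminorm_continuous[OF p, of UNIV] orbit]) simp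
    then show ?thesis
      using S by (intro bounded_imp_bdd_above compact_imp_bounded compact_continuous_image)
  qed
  have upper: "p (T s x) \<le> q x" if "s \<in> S" for s x
    unfolding q_def using that bdd by (rule cSUP_upper)
  have least: "q x \<le> c" if "\<And>s. s \<in> S \<Longrightarrow> p (T s x) \<le> c" for x c
    unfolding q_def using False that by (rule cSUP_least)
  have "continuous_seminorm smul q"
  proof (rule continuous_seminormI[OF vector_space_axioms])
    fix x y
    show "0 \<le> q x"
      using False upper[of _ x] seminorm_nonneg[OF p] by (meson ex_in_conv order_trans)
    show "q (x + y) \<le> q x + q y"
    proof (rule least)
      fix s assume s: "s \<in> S"
      interpret Ts: Vector_Spaces.linear smul smul "T s" by (rule lin[OF s])
      have "p (T s (x + y)) \<le> p (T s x) + p (T s y)"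
        using seminorm_add[OF p] by (simp add: Ts.add)
      then show "p (T s (x + y)) \<le> q x + q y"
        using upper[OF s, of x] upper[OF s, of y] by simp
    qed
  next
    fix c x
    have pT: "p (T s (smul c x)) = norm c * p (T s x)" if s: "s \<in> S" for s c x
    proof -
      interpret Ts: Vector_Spaces.linear smul smul "T s" by (rule lin[OF s])
      show ?thesis using seminorm_scale[OF p] by (simp add: Ts.scale)
    qed
    show "q (smul c x) \<le> norm c * q x"
      by (rule least) (simp add: pT upper mult_left_mono)
  next
    fix e :: real assume e: "e > 0"
    \<comment> \<open>The supremum preserves only non-strict bounds, so \<open>e / 2\<close> leaves
      room for \<open>q y < e\<close>.\<close>
    have "\<forall>\<^sub>F y in nhds 0. \<forall>f\<in>\<Phi> ` (S \<times> U). dist (f y) (f 0) < e / 2"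
      using equi half_gt_zero[OF e] unfolding equicontinuous_def by blast
    then show "\<forall>\<^sub>F y in nhds 0. q y < e"
    proof eventually_elim
      case (elim y)
      have "q y \<le> e / 2"
      proof (rule least)
        fix s assume s: "s \<in> S"
        interpret Ts: Vector_Spaces.linear smul smul "T s" by (rule lin[OF s])
        \<comment> \<open>A norming functional at \<open>T s y\<close> belongs to \<open>U\<close>
          and turns the equicontinuity estimate into a bound on \<open>p (T s y)\<close>.\<close>
        obtain f where f: "Vector_Spaces.linear smul (*) f" "\<And>x. norm (f x) \<le> p x"
            "norm (f (T s y)) = p (T s y)"
          using hahn_banach_seminorm[OF vector_space_axioms seminorm_add[OF p] seminorm_scale[OF p],
              of "T s y"] by blast
        interpret f: Vector_Spaces.linear smul "(*)" f by (rule f(1))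
        have "\<Phi> (s, f) \<in> \<Phi> ` (S \<times> U)"
          using s f by (auto simp: U_def)
        then have "dist (\<Phi> (s, f) y) (\<Phi> (s, f) 0) < e / 2"
          using elim by blast
        then show "p (T s y) \<le> e / 2"
          using f(3) by (simp add: \<Phi>_def Ts.zero f.zero)
      qed
      then show ?case using e by simp
    qed
  qed
  then show thesis using upper by (rule that)
qed

section \<open>From a dense set and local equicontinuity to strong continuity\<close>

text \<open>For \<open>d\<close> in \<open>D\<close> near \<open>x\<close>, the error
  \<open>p (T t x - x)\<close> is at most \<open>q (x - d) + p (T t d - d) + p (d - x)\<close>,
  where \<open>q\<close> controls all times up to 1.\<close>

lemma (in locally_convex_space) tendsto_at_right_zero_dense:
  assumes D: "closure D = UNIV" "\<And>x. x \<in> D \<Longrightarrow> ((\<lambda>t. T t x) \<longlongrightarrow> x) (at_right 0)"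
    and lin: "\<And>t. t \<ge> 0 \<Longrightarrow> Vector_Spaces.linear smul smul (T t)"
    and equi: "locally_equicontinuous smul T"
  shows "((\<lambda>t. T t x) \<longlongrightarrow> x) (at_right 0)"
proof (rule tendsto_seminormI)
  fix p assume p: "continuous_seminorm smul p"
  obtain q where q: "continuous_seminorm smul q" "\<And>x s. s \<in> {0..1} \<Longrightarrow> p (T s x) \<le> q x"
    using equi p unfolding locally_equicontinuous_def by (metis zero_le_one)
  show "((\<lambda>t. p (T t x - x)) \<longlongrightarrow> 0) (at_right 0)"
  proof (rule tendstoI)
    fix e :: real assume e: "e > 0"
    \<comment> \<open>The two error terms independent of \<open>t\<close> are collected first;
      \<open>W\<close> is an open neighbourhood of \<open>x\<close>, so it meets
      \<open>D\<close>.\<close>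
    define W where "W = {d. q (x - d) + p (d - x) < e / 2}"
    have "open W"
      unfolding W_def
      by (intro open_Collect_less continuous_intros
          continuous_on_compose2[OF seminorm_continuous[OF p, of UNIV]]
          continuous_on_compose2[OF seminorm_continuous[OF q(1), of UNIV]]) auto
    moreover have "x \<in> W"
      using e by (simp add: W_def seminorm_zero[OF p vector_space_axioms] seminorm_zero[OF q(1) vector_space_axioms])
    ultimately obtain d where d: "d \<in> D" "d \<in> W"
      using D(1) by (metis UNIV_I closure_iff_nhds_not_empty disjoint_iff subset_refl)
    have "((\<lambda>t. p (T t d - d)) \<longlongrightarrow> 0) (at_right 0)"
      using D(2)[OF d(1)] by (rule seminorm_tendsto_zero[OF p vector_space_axioms])
    then have "\<forall>\<^sub>F t in at_right 0. p (T t d - d) < e / 2"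
      using e by (intro order_tendstoD) auto
    moreover have "\<forall>\<^sub>F t::real in at_right 0. t \<in> {0<..<1}"
      by (rule eventually_at_right_real) simp
    ultimately show "\<forall>\<^sub>F t in at_right 0. dist (p (T t x - x)) 0 < e"
    proof eventually_elim
      case (elim t)
      then interpret Tt: Vector_Spaces.linear smul smul "T t" by (intro lin) auto
      have eq: "T t x - x = T t (x - d) + ((T t d - d) + (d - x))"
        by (simp add: Tt.diff)
      then have "p (T t x - x) \<le> p (T t (x - d)) + (p (T t d - d) + p (d - x))"
        using seminorm_add[OF p, of "T t (x - d)" "(T t d - d) + (d - x)"]
          seminorm_add[OF p, of "T t d - d" "d - x"] unfolding eq by linarith
      moreover have "p (T t (x - d)) \<le> q (x - d)"
        using elim by (intro q(2)) auto
      ultimately show ?case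
        using elim d(2) seminorm_nonneg[OF p, of "T t x - x"] by (simp add: W_def)
    qed
  qed
qed

text \<open>Pulling out \<open>T (min t t0)\<close> reduces both one-sided limits at
  \<open>t0\<close> to the right-hand limit at 0.\<close>

lemma (in locally_convex_space) strongly_continuousI:
  assumes T: "operator_semigroup smul T"
    and equi: "locally_equicontinuous smul T"
    and lim: "\<And>x. ((\<lambda>t. T t x) \<longlongrightarrow> x) (at_right 0)"
  shows "strongly_continuous T"
  unfolding strongly_continuous_def continuous_on_def
proof (intro allI ballI)
  fix x and t0 :: real assume t0: "t0 \<in> {0..}"
  have lin: "Vector_Spaces.linear smul smul (T t)" if "t \<ge> 0" for t
    using T that by (simp add: operator_semigroup_def)
  have T0: "T 0 = id" and semi: "\<And>s t y. s \<ge> 0 \<Longrightarrow> t \<ge> 0 \<Longrightarrow> T (s + t) y = T s (T t y)"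
    using T by (auto simp: operator_semigroup_def fun_eq_iff)
  show "((\<lambda>t. T t x) \<longlongrightarrow> T t0 x) (at t0 within {0..})"
  proof (rule tendsto_seminormI)
    fix p assume p: "continuous_seminorm smul p"
    \<comment> \<open>The horizon \<open>t0 + 1\<close> lets one seminorm \<open>q\<close> serve for
      times on both sides of \<open>t0\<close>.\<close>
    obtain q where q: "continuous_seminorm smul q" "\<And>x s. s \<in> {0..t0 + 1} \<Longrightarrow> p (T s x) \<le> q x"
      using equi p t0 unfolding locally_equicontinuous_def
      by (metis add_nonneg_nonneg atLeast_iff zero_le_one)
    have bound: "p (T t x - T t0 x) \<le> q (T \<bar>t - t0\<bar> x - x)" if t: "t \<in> {0..t0 + 1}" for t
    proof -
      define s where "s = min t t0"
      define h where "h = \<bar>t - t0\<bar>"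
      have s: "s \<ge> 0" "s \<in> {0..t0 + 1}" and h: "h \<ge> 0" using t t0 by (auto simp: s_def h_def)
      interpret Ts: Vector_Spaces.linear smul smul "T s" by (rule lin[OF s(1)])
      \<comment> \<open>The times \<open>t\<close> and \<open>t0\<close> are \<open>s + h\<close>
        and \<open>s\<close> in one order or the other, and \<open>p\<close> does not see the sign
        of the difference.\<close>
      have "p (T t x - T t0 x) = p (T (s + h) x - T s x)"
      proof (cases "t \<le> t0")
        case True
        then show ?thesis
          using seminorm_minus[OF p vector_space_axioms, of "T t x - T t0 x"] by (simp add: s_def h_def)
      qed (simp add: s_def h_def)
      also have "\<dots> = p (T s (T h x - x))"
        using s(1) h by (simp add: semi Ts.diff)
      also have "\<dots> \<le> q (T h x - x)" using s(2) by (rule q(2))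
      finally show ?thesis by (simp add: h_def)
    qed
    have "((\<lambda>h. T h x) \<longlongrightarrow> T 0 x) (at 0 within {0..})"
      using lim[of x] by (simp add: T0 at_within_Ici_at_right)
    then have "continuous (at 0 within {0..}) (\<lambda>h. T h x)"
      by (simp add: continuous_within)
    moreover have "((\<lambda>t. \<bar>t - t0\<bar>) \<longlongrightarrow> 0) (at t0 within {0..})"
      by (auto intro!: tendsto_eq_intros)
    ultimately have "((\<lambda>t. T \<bar>t - t0\<bar> x) \<longlongrightarrow> T 0 x) (at t0 within {0..})"
      by (intro continuous_within_tendsto_compose[where S = "{0..}" and f = "\<lambda>h. T h x"]) auto
    then have "((\<lambda>t. q (T \<bar>t - t0\<bar> x - x)) \<longlongrightarrow> 0) (at t0 within {0..})"
      using seminorm_tendsto_zero[OF q(1) vector_space_axioms] by (simp add: T0)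
    then show "((\<lambda>t. p (T t x - T t0 x)) \<longlongrightarrow> 0) (at t0 within {0..})"
    proof (rule Lim_null_comparison[rotated])
      have "\<forall>\<^sub>F t in at t0 within {0..}. t < t0 + 1"
        by (rule order_tendstoD(2)[OF tendsto_ident_at]) simp
      moreover have "\<forall>\<^sub>F t in at t0 within {0..}. t \<in> {0..}"
        by (simp add: eventually_at_filter)
      ultimately show "\<forall>\<^sub>F t in at t0 within {0..}. norm (p (T t x - T t0 x)) \<le> q (T \<bar>t - t0\<bar> x - x)"
        by eventually_elim (use bound seminorm_nonneg[OF p] in auto)
    qed
  qed
qed

theorem proposition3p4:
  fixes smul :: "'k::{real_normed_field, euclidean_space} \<Rightarrow> 'a::topological_ab_group_add \<Rightarrow> 'a"
    and T :: "real \<Rightarrow> 'a \<Rightarrow> 'a"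
  assumes "strong_mackey_space smul"
    and "operator_semigroup smul T"
    and "\<And>t. t \<ge> 0 \<Longrightarrow> continuous_on UNIV (T t)"
  shows "strongly_continuous T \<longleftrightarrow>
    (\<exists>D. closure D = UNIV \<and> (\<forall>x\<in>D. ((\<lambda>t. T t x) \<longlongrightarrow> x) (at_right 0))) \<and>
    locally_equicontinuous smul T"
proof -
  interpret strong_mackey_space smul by (fact assms(1))
  have lin: "Vector_Spaces.linear smul smul (T t)" if "t \<ge> 0" for t
    using assms(2) that by (simp add: operator_semigroup_def)
  have T0: "T 0 = id"
    using assms(2) by (simp add: operator_semigroup_def)
  show ?thesis
  proof (intro iffI conjI)
    assume sc: "strongly_continuous T"
    have "((\<lambda>t. T t x) \<longlongrightarrow> x) (at_right 0)" for x
    proof -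
      have "continuous_on {0..} (\<lambda>t. T t x)"
        using sc by (simp add: strongly_continuous_def)
      \<comment> \<open>Within \<open>{0..}\<close> the limit at 0 is the right-hand limit, so the
        whole space can serve as the dense set.\<close>
      then have "((\<lambda>t. T t x) \<longlongrightarrow> T 0 x) (at 0 within {0..})"
        by (simp add: continuous_on_def)
      then show ?thesis by (simp add: T0 at_within_Ici_at_right)
    qed
    then show "\<exists>D. closure D = UNIV \<and> (\<forall>x\<in>D. ((\<lambda>t. T t x) \<longlongrightarrow> x) (at_right 0))"
      by (intro exI[of _ UNIV]) simp
    show "locally_equicontinuous smul T"
      unfolding locally_equicontinuous_def
    proof (intro allI impI)
      fix t :: real and p assume p: "continuous_seminorm smul p"
      have orbit: "continuous_on {0..t} (\<lambda>s. T s x)" for x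
        using sc by (auto simp: strongly_continuous_def intro: continuous_on_subset[of "{0..}"])
      obtain q where "continuous_seminorm smul q" "\<And>s x. s \<in> {0..t} \<Longrightarrow> p (T s x) \<le> q x"
        using strongly_continuous_family_equicontinuous[of "{0..t}" T p] lin assms(3) orbit p
        by auto
      then show "\<exists>q. continuous_seminorm smul q \<and> (\<forall>x. \<forall>s\<in>{0..t}. p (T s x) \<le> q x)"
        by blast
    qed
  next
    assume "(\<exists>D. closure D = UNIV \<and> (\<forall>x\<in>D. ((\<lambda>t. T t x) \<longlongrightarrow> x) (at_right 0))) \<and>
      locally_equicontinuous smul T"
    then obtain D where D: "closure D = UNIV" "\<And>x. x \<in> D \<Longrightarrow> ((\<lambda>t. T t x) \<longlongrightarrow> x) (at_right 0)"
      and equi: "locally_equicontinuous smul T" by blast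
    show "strongly_continuous T"
      using tendsto_at_right_zero_dense[OF D lin equi] by (rule strongly_continuousI[OF assms(2) equi])
  qed
qed

end
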